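(* Assume the explicit abc conjecture. Then there are only finitely many nontrivial solutions of the equation $$\prod_{i=1}^{t} a_i!! = n!!, \qquad n>a_1\geq a_2\geq\cdots\geq a_t\geq 3,\quad t>1,$$ in positive integers $n,t,a_1,\dots,a_t$ such that all of $a_1,\dots,a_t$ are even.
   Context: For a positive integer $m$, $m!!$ denotes the double factorial: $m!!=1\cdot 3\cdots (2l-1)$ if $m=2l-1$ is odd, and $m!!=2\cdot 4\cdots 2l$ if $m=2l$ is even. If all $a_i$ are even, then $n$ is necessarily even. In this case a solution is called trivial if $n-a_1=2$, and nontrivial otherwise. For a non-zero integer $a$, let $N(a)=\prod_{p\mid a}p$ (product over the distinct primes dividing $a$). The explicit abc conjecture is the assertion: whenever $a,b,c$ are coprime non-zero integers with $a+b=c$, one has $c<N(abc)^{7/4}$. *)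

theory Defs
  imports Complex_Main "HOL-Computational_Algebra.Primes"
begin

(* For m = 0 the product is empty, so double_fact 0 = 1; only m \<ge> 1 matters below. *)
definition double_fact :: "nat \<Rightarrow> nat" where
  "double_fact m =
     (if odd m then (\<Prod>i = 1..(m + 1) div 2. 2 * i - 1)
      else (\<Prod>i = 1..m div 2. 2 * i))"

definition rad :: "int \<Rightarrow> int" where
  "rad a = (\<Prod>p | prime p \<and> p dvd a. p)"

(* Coprimality of a, b, c means that they have no common prime factor; because a + b = c
   this is the same as pairwise coprimality. *)
definition explicit_abc :: bool where
  "explicit_abc \<longleftrightarrow>
     (\<forall>a b c :: int. a \<noteq> 0 \<and> b \<noteq> 0 \<and> c \<noteq> 0 \<and> Gcd {a, b, c} = 1 \<and> a + b = c \<longrightarrow>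
        real_of_int c < real_of_int (rad (a * b * c)) powr (7 / 4))"

(* The list [a_1, ..., a_t] carries the number t of factors as its length. *)
definition is_solution :: "nat \<Rightarrow> nat list \<Rightarrow> bool" where
  "is_solution n as \<longleftrightarrow>
     (\<Prod>a\<leftarrow>as. double_fact a) = double_fact n \<and>
     length as > 1 \<and> n > hd as \<and> sorted_wrt (\<ge>) as \<and> last as \<ge> 3"

(* Only used for solutions with all a_i even; there n > hd as, so the subtraction does not
   truncate. *)
definition trivial_solution :: "nat \<Rightarrow> nat list \<Rightarrow> bool" where
  "trivial_solution n as \<longleftrightarrow> is_solution n as \<and> n - hd as = 2"

end

theory Submission
  imports Defs "HOL-Real_Asymp.Real_Asymp"
begin

text \<open>
  Since the double factorial of \<open>2m\<close> is \<open>2 ^ m * m!\<close>, a solution with even entries is an identity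
  \<open>2 ^ k * (b + 1) \<cdots> (b + k) = \<Prod> 2 ^ a * a!\<close>, where \<open>a\<close> runs over a list \<open>bs\<close> of integers
  with \<open>2 \<le> a \<le> b\<close>; here \<open>a\<^sub>1 = 2b\<close> and \<open>n = 2(b + k)\<close>, and nontrivial means \<open>k \<ge> 2\<close>. The task is to
  bound \<open>b\<close>.

  The powers of 2 on both sides show that the entries of \<open>bs\<close> have sum \<open>O(k + ln b)\<close>, with a sharp
  constant for the total 2-adic valuation. As \<open>2 ^ a * a! \<le> (a + 1) ^ a\<close> is smaller than
  \<open>(2b) ^ a\<close> by an exponential factor, the sizes of the two sides can agree only if \<open>k\<close> is
  polylogarithmic in \<open>b\<close>; then the entries are polylogarithmic as well, and repeating the
  comparison gives \<open>2k \<le> log\<^sub>2 (b + 1)\<close> and a bound \<open>(3/2) log\<^sub>2 (b + 1)\<close> for the sum of \<open>bs\<close>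
  (\<open>reduced_solution_log_bound\<close>).

  Now abc enters. All primes dividing \<open>b + 1, \<dots>, b + k\<close> are at most the largest entry \<open>q\<close> of \<open>bs\<close>.
  For each pair of neighbours \<open>x, x + 1\<close> among these integers the radical of \<open>x (x + 1)\<close> exceeds
  \<open>x ^ (4/7)\<close>, large primes occur in only one pair, and the product of the primes up to \<open>q\<close> is at
  most \<open>4 ^ q\<close> (\<open>explicit_abc_pairs\<close>). As \<open>q = O(ln b)\<close>, only boundedly many pairs fit, so \<open>k\<close> is
  bounded by an absolute constant. One pair exists because \<open>k \<ge> 2\<close>, so \<open>q\<close> is also bounded below by
  a multiple of \<open>ln b\<close>. But \<open>q!\<close> divides the right side, hence is at most a fixed power of \<open>b\<close>, and
  this fails for large \<open>q\<close> (\<open>no_large_reduced_solution\<close>).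

  Finally a bound for \<open>b\<close> bounds \<open>n\<close>, because no odd prime lies in \<open>(b, b + k]\<close>.
\<close>

section \<open>Double factorials and the 2-adic valuation of factorials\<close>

lemma double_fact_double: "double_fact (2 * m) = 2 ^ m * fact m"
  by (simp add: double_fact_def fact_prod prod.distrib)

lemma odd_double_fact: "odd n \<Longrightarrow> odd (double_fact n)"
  by (auto simp: double_fact_def even_prod_iff)

definition v2_fact :: "nat \<Rightarrow> nat" where
  "v2_fact n = multiplicity 2 (fact n :: nat)"

lemma v2_fact_0 [simp]: "v2_fact 0 = 0"
  by (simp add: v2_fact_def)

lemma v2_fact_Suc: "v2_fact (Suc n) = multiplicity 2 (Suc n) + v2_fact n"
  unfolding v2_fact_def fact_Suc of_nat_id
  by (subst prime_elem_multiplicity_mult_distrib) auto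

lemma v2_fact_double: "v2_fact (2 * c) = c + v2_fact c"
proof (induction c)
  case (Suc c)
  have "multiplicity 2 (Suc (2 * c)) = 0"
    by (rule not_dvd_imp_multiplicity_0) simp
  moreover have "multiplicity 2 (2 * Suc c) = Suc (multiplicity 2 (Suc c))"
    by (rule multiplicity_times_same) auto
  moreover have "2 * Suc c = Suc (Suc (2 * c))" by simp
  ultimately show ?case
    using Suc.IH by (metis v2_fact_Suc add.assoc add.commute add.left_commute add_0 add_Suc_right)
qed simp

lemma v2_fact_double_Suc: "v2_fact (Suc (2 * c)) = c + v2_fact c"
proof -
  have "multiplicity 2 (Suc (2 * c)) = 0"
    by (rule not_dvd_imp_multiplicity_0) simp
  then show ?thesis by (simp add: v2_fact_Suc v2_fact_double)
qed

lemma v2_fact_div_2: "v2_fact n = n div 2 + v2_fact (n div 2)"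
  by (cases "even n") (auto elim!: evenE oddE simp: v2_fact_double v2_fact_double_Suc)

lemma v2_fact_le: "v2_fact n \<le> n"
proof (induction n rule: less_induct)
  case (less n)
  show ?case
  proof (cases "n = 0")
    case False
    have "v2_fact (n div 2) \<le> n div 2" using less False by simp
    then show ?thesis using v2_fact_div_2[of n] by linarith
  qed simp
qed

lemma v2_fact_ge_third:
  assumes "2 \<le> n" shows "n \<le> 3 * v2_fact n"
proof -
  have "n div 2 \<le> v2_fact n" using v2_fact_div_2[of n] by simp
  then show ?thesis using assms by linarith
qed

text \<open>
  This is \<open>n - log\<^sub>2 (n + 1) \<le> v\<^sub>2(n!)\<close> without logarithms, so that the halving step
  \<open>v\<^sub>2(n!) = \<lfloor>n/2\<rfloor> + v\<^sub>2(\<lfloor>n/2\<rfloor>!)\<close> can be used for an induction in the natural numbers.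
\<close>
lemma two_power_le_v2_fact: "2 ^ n \<le> 2 ^ v2_fact n * (n + 1)"
proof (induction n rule: less_induct)
  case (less n)
  show ?case
  proof (cases "n = 0")
    case False
    define c where "c = n div 2"
    have IH: "2 ^ c \<le> 2 ^ v2_fact c * (c + 1)" using less False by (simp add: c_def)
    have v: "v2_fact n = c + v2_fact c" unfolding c_def by (rule v2_fact_div_2)
    have "(2::nat) ^ n = 2 ^ c * (2 ^ c * 2 ^ (n mod 2))"
      by (simp add: c_def flip: power_add) (metis mult_2 mult_div_mod_eq add.assoc)
    also have "\<dots> \<le> 2 ^ c * ((2 ^ v2_fact c * (c + 1)) * 2 ^ (n mod 2))"
      using IH by (intro mult_left_mono mult_right_mono) auto
    also have "\<dots> = 2 ^ v2_fact n * ((c + 1) * 2 ^ (n mod 2))"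
      by (simp add: v power_add algebra_simps)
    also have "(c + 1) * 2 ^ (n mod 2) \<le> n + 1"
      by (cases "even n") (auto elim!: evenE oddE simp: c_def)
    finally show ?thesis by simp
  qed simp
qed

text \<open>
  The arithmetic-geometric mean inequality for \<open>1, \<dots>, n\<close>. What it saves over the trivial
  bound \<open>n! \<le> n ^ n\<close> absorbs the powers of 2 that the double factorials contribute.
\<close>
lemma two_power_fact_le: "2 ^ n * fact n \<le> ((n + 1) ^ n :: nat)"
proof (induction n)
  case (Suc n)
  have b: "2 * (n + 1) ^ (n + 1) \<le> (n + 2) ^ (n + 1)"
  proof -
    have "1 + real (n + 1) * (1 / real (n + 1)) \<le> (1 + 1 / real (n + 1)) ^ (n + 1)"
      by (rule Bernoulli_inequality) (simp add: field_simps)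
    then have "2 \<le> ((real n + 2) / (real n + 1)) ^ (n + 1)"
      by (simp add: field_simps)
    then have "2 * (real n + 1) ^ (n + 1) \<le> (real n + 2) ^ (n + 1)"
      by (simp add: power_divide field_simps del: power_Suc)
    then have "real (2 * (n + 1) ^ (n + 1)) \<le> real ((n + 2) ^ (n + 1))"
      by (simp del: power_Suc add: add.commute)
    then show ?thesis by (simp only: of_nat_le_iff)
  qed
  have "2 ^ Suc n * fact (Suc n) = 2 * (n + 1) * (2 ^ n * fact n)" by (simp add: algebra_simps)
  also have "\<dots> \<le> 2 * (n + 1) * (n + 1) ^ n" by (intro mult_left_mono Suc) auto
  also have "\<dots> = 2 * (n + 1) ^ (n + 1)" by simp
  also note b
  finally show ?case by (simp add: add.commute)
qed simp

section \<open>The product of the primes up to a bound\<close>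

lemma prod_primes_dvd:
  fixes n :: nat
  assumes "finite P" "\<And>p. p \<in> P \<Longrightarrow> prime p" "\<And>p. p \<in> P \<Longrightarrow> p dvd n"
  shows "\<Prod>P dvd n"
  using assms
proof (induction P rule: finite_induct)
  case (insert p P)
  then have "coprime p (\<Prod>P)"
    by (intro prod_coprime_right primes_coprime) auto
  then show ?case using insert by (simp add: divides_mult)
qed simp

text \<open>
  Erdos's argument: all primes \<open>p\<close> with \<open>l + 1 < p \<le> 2l + 1\<close> divide the binomial coefficient
  \<open>2l + 1\<close> over \<open>l\<close>, which is at most \<open>4 ^ l\<close>.
\<close>
lemma prod_primes_le_4_power: "\<Prod>{p. prime p \<and> p \<le> n} \<le> (4::nat) ^ n"
proof (induction n rule: less_induct)
  case (less n)
  consider "n \<le> 1" | "n = 2" | "n > 2" "even n" | "n > 2" "odd n" by linarith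
  then show ?case
  proof cases
    case 1
    then have "{p. prime p \<and> p \<le> n} = {}" by (auto dest: prime_ge_2_nat)
    then show ?thesis by (simp only: prod.empty) simp
  next
    case 2
    then have "{p. prime p \<and> p \<le> n} = {2}" by (auto dest: prime_ge_2_nat)
    then have "\<Prod>{p. prime p \<and> p \<le> n} = 2" by (simp only:) simp
    then show ?thesis by (simp only: 2) simp
  next
    case 3
    have "\<not> prime n" using 3 prime_odd_nat[of n] by auto
    then have "p \<le> n \<longleftrightarrow> p \<le> n - 1" if "prime p" for p
      using that 3 by (cases "p = n") auto
    then have "{p. prime p \<and> p \<le> n} = {p. prime p \<and> p \<le> n - 1}" by blast
    also have "\<Prod>\<dots> \<le> 4 ^ (n - 1)" using less[of "n - 1"] 3 by simp
    also have "\<dots> \<le> 4 ^ n" by (intro power_increasing) auto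
    finally show ?thesis .
  next
    case 4
    then obtain l where n: "n = 2 * l + 1" by (auto elim: oddE)
    have l: "l \<ge> 1" using 4 n by simp
    let ?A = "{p. prime p \<and> p \<le> l + 1}" and ?B = "{p. prime p \<and> l + 1 < p \<and> p \<le> n}"
    have split: "{p. prime p \<and> p \<le> n} = ?A \<union> ?B" using n l by auto
    have "p dvd n choose l" if p: "p \<in> ?B" for p
    proof -
      have "p dvd fact n" using p by (simp add: prime_dvd_fact_iff)
      also have "fact n = fact l * fact (n - l) * (n choose l)"
        using n by (intro binomial_fact_lemma[symmetric]) auto
      finally have "p dvd fact l * fact (n - l) * (n choose l)" .
      moreover have "\<not> p dvd fact l" "\<not> p dvd fact (n - l)"
        using p n by (simp_all add: prime_dvd_fact_iff del: fact_Suc)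
      ultimately show "p dvd n choose l" using p by (simp add: prime_dvd_mult_iff)
    qed
    then have "\<Prod>?B dvd n choose l"
      by (intro prod_primes_dvd) auto
    moreover have "n choose l > 0" using n by (simp add: zero_less_binomial_iff)
    ultimately have B: "\<Prod>?B \<le> n choose l" by (rule dvd_imp_le)
    have "n choose l \<le> (\<Sum>i\<le>l. n choose i)" by (intro member_le_sum) auto
    also have "\<dots> = 4 ^ l" using binomial_r_part_sum[of l] by (simp add: n power_mult)
    finally have "n choose l \<le> 4 ^ l" .
    with B have B': "\<Prod>?B \<le> 4 ^ l" by simp
    have "\<Prod>{p. prime p \<and> p \<le> n} = \<Prod>?A * \<Prod>?B"
      unfolding split by (rule prod.union_disjoint) auto
    also have "\<dots> \<le> 4 ^ (l + 1) * 4 ^ l"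
      using less[of "l + 1"] l n B' by (intro mult_mono) auto
    also have "\<dots> = 4 ^ n" by (simp add: n flip: power_add)
    finally show ?thesis .
  qed
qed

section \<open>The reduced equation and the comparison of sizes and valuations\<close>

text \<open>The 2-adic valuation of the double factorial of \<open>2a\<close>, that is, of \<open>2 ^ a * fact a\<close>.\<close>
definition weight :: "nat \<Rightarrow> nat" where
  "weight a = a + v2_fact a"

lemma multiplicity_two_power_fact: "multiplicity 2 (2 ^ a * fact a :: nat) = weight a"
  by (subst prime_elem_multiplicity_mult_distrib) (auto simp: weight_def v2_fact_def)

lemma prod_list_two_power_fact_pos: "(\<Prod>a\<leftarrow>bs. 2 ^ a * fact a :: nat) > 0"
  by (induction bs) auto

lemma multiplicity_prod_list_two_power_fact:
  "multiplicity 2 (\<Prod>a\<leftarrow>bs. 2 ^ a * fact a :: nat) = (\<Sum>a\<leftarrow>bs. weight a)"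
proof (induction bs)
  case (Cons a bs)
  have "multiplicity 2 ((2 ^ a * fact a) * (\<Prod>a\<leftarrow>bs. 2 ^ a * fact a :: nat)) =
      multiplicity 2 (2 ^ a * fact a :: nat) + multiplicity 2 (\<Prod>a\<leftarrow>bs. 2 ^ a * fact a :: nat)"
    using prod_list_two_power_fact_pos[of bs]
    by (intro prime_elem_multiplicity_mult_distrib) auto
  then show ?case using Cons by (simp add: multiplicity_two_power_fact)
qed simp

text \<open>
  The constant \<open>4/3\<close> is attained at \<open>a = 3\<close>. Through this inequality a bound for the total
  weight bounds the sum of the entries themselves.
\<close>
lemma weight_ge_four_thirds: "2 \<le> a \<Longrightarrow> 4 * a \<le> 3 * weight a"
  using v2_fact_ge_third[of a] by (simp add: weight_def)

lemma le_v2_fact_add_log: "real n \<le> real (v2_fact n) + log 2 (real n + 1)"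
proof -
  have "real (2 ^ n) \<le> real (2 ^ v2_fact n * (n + 1))"
    using two_power_le_v2_fact[of n] by (simp only: of_nat_le_iff)
  then have "(2::real) ^ n \<le> 2 ^ v2_fact n * (real n + 1)"
    by (simp only: of_nat_mult of_nat_power of_nat_numeral of_nat_add of_nat_1)
  then have "log 2 (2 ^ n) \<le> log 2 (2 ^ v2_fact n * (real n + 1))"
    by (subst log_le_cancel_iff) auto
  then show ?thesis by (simp add: log_mult log_nat_power)
qed

lemma power_mult_fact_le: "b ^ k * fact b \<le> (fact (b + k) :: nat)"
proof (induction k)
  case (Suc k)
  have "b ^ Suc k * fact b = b * (b ^ k * fact b)" by simp
  also have "\<dots> \<le> (b + Suc k) * fact (b + k)" by (intro mult_mono Suc) auto
  finally show ?case by simp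
qed simp

text \<open>
  A solution with even entries has \<open>a\<^sub>1 = 2b\<close>, \<open>n = 2(b + k)\<close>, and \<open>bs\<close> lists the halves of
  \<open>a\<^sub>2, \<dots>, a\<^sub>t\<close>; the common factor \<open>2 ^ b\<close> of both sides is cancelled. The trivial solutions are those
  with \<open>k = 1\<close>.
\<close>
definition reduced_solution :: "nat \<Rightarrow> nat \<Rightarrow> nat list \<Rightarrow> bool" where
  "reduced_solution b k bs \<longleftrightarrow>
     (\<forall>a\<in>set bs. 2 \<le> a \<and> a \<le> b) \<and>
     (2 ^ k * fact (b + k) :: nat) = fact b * (\<Prod>a\<leftarrow>bs. 2 ^ a * fact a)"

text \<open>
  Comparison of the powers of 2 on the two sides. The leading coefficient 2 of \<open>k\<close> is sharp, which
  matters in the first estimate for \<open>k\<close> below; only the logarithmic term is lossy.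
\<close>
lemma reduced_solution_weight_sum_le:
  assumes "reduced_solution b k bs"
  shows "real (\<Sum>a\<leftarrow>bs. weight a) \<le> 2 * real k + log 2 (real b + 1)"
proof -
  let ?P = "\<Prod>a\<leftarrow>bs. 2 ^ a * fact a :: nat"
  have "multiplicity 2 (2 ^ k * fact (b + k) :: nat) = k + v2_fact (b + k)"
    by (subst prime_elem_multiplicity_mult_distrib) (auto simp: v2_fact_def)
  moreover have "multiplicity 2 (fact b * ?P) = v2_fact b + (\<Sum>a\<leftarrow>bs. weight a)"
    using prod_list_two_power_fact_pos[of bs]
    by (subst prime_elem_multiplicity_mult_distrib)
      (auto simp: v2_fact_def multiplicity_prod_list_two_power_fact)
  moreover define W where "W = (\<Sum>a\<leftarrow>bs. weight a)"
  ultimately have "k + v2_fact (b + k) = v2_fact b + W"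
    using assms by (simp add: reduced_solution_def)
  then have "v2_fact b + W \<le> 2 * k + b"
    using v2_fact_le[of "b + k"] by linarith
  then have "real (v2_fact b) + real W \<le> 2 * real k + real b"
    by linarith
  with le_v2_fact_add_log[of b] have "real W \<le> 2 * real k + log 2 (real b + 1)" by linarith
  then show ?thesis by (simp only: W_def)
qed

lemma reduced_solution_sum_le:
  assumes "reduced_solution b k bs"
  shows "real (sum_list bs) \<le> 3 / 4 * (2 * real k + log 2 (real b + 1))"
proof -
  have "\<forall>a\<in>set bs. 2 \<le> a" using assms by (simp add: reduced_solution_def)
  then have "4 * sum_list bs \<le> 3 * (\<Sum>a\<leftarrow>bs. weight a)"
  proof (induction bs)
    case (Cons a bs)
    then show ?case using weight_ge_four_thirds[of a] by simp
  qed simp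
  moreover define S W where "S = sum_list bs" and "W = (\<Sum>a\<leftarrow>bs. weight a)"
  ultimately have "4 * real S \<le> 3 * real W" by linarith
  then show ?thesis
    using reduced_solution_weight_sum_le[OF assms] unfolding S_def[symmetric] W_def[symmetric]
    by (simp add: field_simps)
qed

text \<open>
  Comparison of sizes: each of the \<open>k\<close> factors \<open>b + 1, \<dots>, b + k\<close> left after cancelling \<open>b!\<close>
  exceeds \<open>b\<close>.
\<close>
lemma reduced_solution_size_le:
  assumes "reduced_solution b k bs"
  shows "(2 * b) ^ k \<le> (\<Prod>a\<leftarrow>bs. (a + 1) ^ a)"
proof -
  have "(2 * b) ^ k * fact b = 2 ^ k * (b ^ k * fact b)"
    by (simp add: power_mult_distrib)
  also have "\<dots> \<le> 2 ^ k * fact (b + k)" by (intro mult_left_mono power_mult_fact_le) auto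
  also have "\<dots> = (\<Prod>a\<leftarrow>bs. 2 ^ a * fact a) * fact b"
    using assms by (simp add: reduced_solution_def)
  finally have "(2 * b) ^ k \<le> (\<Prod>a\<leftarrow>bs. 2 ^ a * fact a)" by simp
  also have "\<dots> \<le> (\<Prod>a\<leftarrow>bs. (a + 1) ^ a)"
  proof (induction bs)
    case (Cons a bs)
    show ?case unfolding list.map prod_list.Cons
      by (intro mult_mono two_power_fact_le Cons) auto
  qed simp
  finally show ?thesis .
qed

text \<open>
  If every entry of \<open>bs\<close> contributes at most \<open>c\<close> times its 2-adic weight to the logarithmic size,
  then the total size is at most \<open>c\<close> times the total weight. The lemma is used with two values of
  \<open>c\<close>: one slightly below \<open>ln (2b) / 2\<close>, and then one that is at most \<open>ln (2b) / 4\<close>.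
\<close>
lemma reduced_solution_comparison:
  assumes sol: "reduced_solution b k bs" and "b > 0" and "0 \<le> c"
    and le: "\<And>a. a \<in> set bs \<Longrightarrow> real a * ln (real a + 1) \<le> c * real (weight a)"
  shows "real k * ln (2 * real b) \<le> c * (2 * real k + log 2 (real b + 1))"
proof -
  have "real ((2 * b) ^ k) \<le> real (\<Prod>a\<leftarrow>bs. (a + 1) ^ a)"
    using reduced_solution_size_le[OF sol] by (simp only: of_nat_le_iff)
  then have "(2 * real b) ^ k \<le> real (\<Prod>a\<leftarrow>bs. (a + 1) ^ a)"
    by (simp only: of_nat_mult of_nat_power of_nat_numeral)
  then have "ln ((2 * real b) ^ k) \<le> ln (real (\<Prod>a\<leftarrow>bs. (a + 1) ^ a))"
    using \<open>b > 0\<close> by (intro ln_mono) auto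
  also have "ln (real (\<Prod>a\<leftarrow>bs. (a + 1) ^ a)) = (\<Sum>a\<leftarrow>bs. real a * ln (real a + 1))"
  proof (induction bs)
    case (Cons a bs)
    have "(\<Prod>a\<leftarrow>bs. (a + 1) ^ a) > (0::nat)" by (induction bs) auto
    then have "real (\<Prod>a\<leftarrow>bs. (a + 1) ^ a) > 0" by linarith
    then show ?case using Cons by (simp add: ln_mult ln_realpow add.commute)
  qed simp
  also have "\<dots> \<le> (\<Sum>a\<leftarrow>bs. c * real (weight a))" by (intro sum_list_mono le)
  also have "\<dots> = c * real (\<Sum>a\<leftarrow>bs. weight a)"
    by (induction bs) (auto simp: algebra_simps)
  also have "\<dots> \<le> c * (2 * real k + log 2 (real b + 1))"
    using reduced_solution_weight_sum_le[OF sol] \<open>0 \<le> c\<close> by (intro mult_left_mono) auto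
  finally show ?thesis using ln_realpow[of "2 * real b" k] \<open>b > 0\<close> by linarith
qed

text \<open>
  The weight of \<open>a\<close> is \<open>2a\<close> up to a logarithm, so for large \<open>a\<close> the quotient of
  \<open>a ln (a + 1)\<close> by the weight is about \<open>ln (a + 1) / 2\<close>, which is below \<open>ln (2b) / 2\<close> by almost
  \<open>ln 2 / 2\<close> since \<open>a \<le> b\<close>. For the finitely many small \<open>a\<close> the quotient is bounded while
  \<open>ln (2b)\<close> grows. The number \<open>1/4\<close> is any constant that is safely below \<open>ln 2\<close>.
\<close>
lemma weight_saving:
  "\<exists>B. \<forall>b\<ge>B. \<forall>a. 2 \<le> a \<and> a \<le> b \<longrightarrow>
     real a * ln (real a + 1) \<le> (ln (2 * real b) - 1 / 4) / 2 * real (weight a)"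
proof -
  have "eventually (\<lambda>a::nat. log 2 (real a + 1) * ln (real a + 1) \<le> real a / 6) sequentially"
    unfolding log_def by real_asymp
  moreover have "eventually (\<lambda>a::nat. 3 / 8 \<le> ln (2 * real a) - ln (real a + 1)) sequentially"
  proof -
    \<comment> \<open>From \<open>e < 4\<close> one gets \<open>ln 2 \<ge> 1/2\<close>.\<close>
    have "ln (exp 1) \<le> ln ((2::real) ^ 2)" using exp_le by (intro ln_mono) auto
    then have "3 / 8 < ln (2::real)" by (simp only: ln_realpow ln_exp)
    moreover have "((\<lambda>a::nat. ln (2 * real a) - ln (real a + 1)) \<longlongrightarrow> ln 2) sequentially"
      by real_asymp
    ultimately have "eventually (\<lambda>a::nat. 3 / 8 < ln (2 * real a) - ln (real a + 1)) sequentially"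
      by (rule order_tendstoD(1)[rotated])
    then show ?thesis by (rule eventually_mono) simp
  qed
  ultimately have "eventually (\<lambda>a::nat. log 2 (real a + 1) * ln (real a + 1) \<le> real a / 6 \<and>
      3 / 8 \<le> ln (2 * real a) - ln (real a + 1)) sequentially"
    by (rule eventually_conj)
  then obtain A where A:
    "\<forall>a\<ge>A. log 2 (real a + 1) * ln (real a + 1) \<le> real a / 6 \<and>
      3 / 8 \<le> ln (2 * real a) - ln (real a + 1)"
    unfolding eventually_sequentially by blast
  have "eventually (\<lambda>b::nat. 2 * ln (real A + 1) \<le> 4 / 3 * (ln (2 * real b) - 1 / 4)) sequentially"
    by real_asymp
  then obtain B where B:
    "\<And>b. b \<ge> B \<Longrightarrow> 2 * ln (real A + 1) \<le> 4 / 3 * (ln (2 * real b) - 1 / 4)"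
    unfolding eventually_sequentially by blast
  show ?thesis
  proof (rule exI[of _ B], intro allI impI, elim conjE)
    fix b a :: nat
    assume "B \<le> b" "2 \<le> a" "a \<le> b"
    have w: "4 / 3 * real a \<le> real (weight a)" using weight_ge_four_thirds[OF \<open>2 \<le> a\<close>] by linarith
    show "real a * ln (real a + 1) \<le> (ln (2 * real b) - 1 / 4) / 2 * real (weight a)"
    proof (cases "A \<le> a")
      case True
      have "2 * real a \<le> real (weight a) + log 2 (real a + 1)"
        using le_v2_fact_add_log[of a] by (simp add: weight_def)
      then have "2 * real a * ln (real a + 1) \<le> (real (weight a) + log 2 (real a + 1)) * ln (real a + 1)"
        by (intro mult_right_mono) auto
      also have "\<dots> \<le> real (weight a) * ln (real a + 1) + real a / 6"
        using A True by (simp add: algebra_simps)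
      also have "\<dots> \<le> real (weight a) * ln (real a + 1) + real (weight a) * (1 / 8)"
        using w by simp
      also have "\<dots> = real (weight a) * (ln (real a + 1) + 1 / 8)" by (simp add: algebra_simps)
      also have "\<dots> \<le> real (weight a) * (ln (2 * real b) - 1 / 4)"
      proof (intro mult_left_mono)
        have "ln (2 * real a) \<le> ln (2 * real b)" using \<open>2 \<le> a\<close> \<open>a \<le> b\<close> by simp
        then show "ln (real a + 1) + 1 / 8 \<le> ln (2 * real b) - 1 / 4"
          using A[rule_format, OF True] by linarith
      qed auto
      finally show ?thesis by (simp add: algebra_simps)
    next
      case False
      have "ln (real a + 1) \<le> ln (real A + 1)" using False by simp
      with B[OF \<open>B \<le> b\<close>] have le: "2 * ln (real a + 1) \<le> 4 / 3 * (ln (2 * real b) - 1 / 4)" by linarith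
      have "0 \<le> 2 * ln (real a + 1)" by simp
      then have "0 \<le> 4 / 3 * (ln (2 * real b) - 1 / 4)" using le by (rule order_trans)
      then have pos: "0 \<le> ln (2 * real b) - 1 / 4" by (simp add: zero_le_mult_iff)
      have "2 * (real a * ln (real a + 1)) \<le> real a * (4 / 3 * (ln (2 * real b) - 1 / 4))"
        using mult_left_mono[OF le, of "real a"] by (simp add: algebra_simps)
      also have "\<dots> = 4 / 3 * real a * (ln (2 * real b) - 1 / 4)" by simp
      also have "\<dots> \<le> real (weight a) * (ln (2 * real b) - 1 / 4)"
        using w pos by (intro mult_right_mono) auto
      finally show ?thesis by (simp add: algebra_simps)
    qed
  qed
qed

text \<open>
  Two rounds of the comparison. In the first, the terms \<open>k ln (2b)\<close> on both sides cancel, and the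
  saving leaves \<open>k\<close> bounded by the square of \<open>ln b\<close> up to a constant. Hence the entries of \<open>bs\<close>
  are polylogarithmic in \<open>b\<close>, so in the second round their logarithms are negligible against
  \<open>ln (2b)\<close>, and \<open>k\<close> and the sum of \<open>bs\<close> are \<open>O(ln b)\<close>.
\<close>
lemma reduced_solution_log_bound:
  "\<exists>B. \<forall>b\<ge>B. \<forall>k bs. reduced_solution b k bs \<longrightarrow>
     2 * real k \<le> log 2 (real b + 1) \<and> 2 * real (sum_list bs) \<le> 3 * log 2 (real b + 1)"
proof -
  obtain B1 where B1: "\<And>b a. b \<ge> B1 \<Longrightarrow> 2 \<le> a \<Longrightarrow> a \<le> b \<Longrightarrow>
     real a * ln (real a + 1) \<le> (ln (2 * real b) - 1 / 4) / 2 * real (weight a)"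
    using weight_saving by blast
  have "eventually (\<lambda>b::nat. 3 * ln (3 / 4 * (2 * (2 * log 2 (real b + 1) * ln (2 * real b)) + log 2 (real b + 1)) + 1)
      \<le> ln (2 * real b)) sequentially"
    unfolding log_def by real_asymp
  then obtain B2 where B2: "\<And>b::nat. b \<ge> B2 \<Longrightarrow>
      3 * ln (3 / 4 * (2 * (2 * log 2 (real b + 1) * ln (2 * real b)) + log 2 (real b + 1)) + 1) \<le> ln (2 * real b)"
    unfolding eventually_sequentially by blast
  show ?thesis
  proof (intro exI[of _ "max 2 (max B1 B2)"] allI impI)
    fix b k bs
    assume b: "max 2 (max B1 B2) \<le> b" and sol: "reduced_solution b k bs"
    define l L where "l = log 2 (real b + 1)" and "L = ln (2 * real b)"
    have "0 < b" using b by linarith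
    have "0 \<le> l" by (simp add: l_def)
    have "exp 1 \<le> 2 * real b" using exp_le b by linarith
    then have "1 \<le> L" unfolding L_def using \<open>0 < b\<close> by (simp add: ln_ge_iff)
    have range: "2 \<le> a" "a \<le> b" "a \<le> sum_list bs" if "a \<in> set bs" for a
      using that sol member_le_sum_list[of a bs] by (auto simp: reduced_solution_def)
    \<comment> \<open>First round: the entries of \<open>bs\<close> are only known to be at most \<open>b\<close>.\<close>
    have "real k * L \<le> (L - 1 / 4) / 2 * (2 * real k + l)"
      unfolding l_def L_def using b \<open>0 < b\<close> \<open>1 \<le> L\<close> range
      by (intro reduced_solution_comparison[OF sol] B1) (auto simp: L_def)
    then have "real k \<le> 2 * l * (L - 1 / 4)" by (simp add: field_simps)
    also have "\<dots> \<le> 2 * l * L" using \<open>0 \<le> l\<close> by (intro mult_left_mono) auto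
    finally have k: "real k \<le> 2 * l * L" .
    have S: "real (sum_list bs) \<le> 3 / 4 * (2 * real k + l)"
      using reduced_solution_sum_le[OF sol] by (simp add: l_def)
    \<comment> \<open>Second round: the entries are at most their sum, whose logarithm is small.\<close>
    define M where "M = ln (real (sum_list bs) + 1)"
    have "0 \<le> M" by (simp add: M_def)
    have "M \<le> ln (3 / 4 * (2 * (2 * l * L) + l) + 1)"
      unfolding M_def using S k by (intro ln_mono) auto
    then have M: "3 * M \<le> L" using B2[of b] b unfolding l_def L_def by simp
    have "real k * L \<le> 3 / 4 * M * (2 * real k + l)"
      unfolding l_def L_def
    proof (intro reduced_solution_comparison[OF sol \<open>0 < b\<close>])
      fix a assume a: "a \<in> set bs"
      have "4 * real a \<le> 3 * real (weight a)"
        using weight_ge_four_thirds[OF range(1)[OF a]] by linarith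
      moreover have "ln (real a + 1) \<le> M" using range(3)[OF a] by (simp add: M_def)
      ultimately have "real a * ln (real a + 1) \<le> (3 / 4 * real (weight a)) * M"
        by (intro mult_mono) auto
      then show "real a * ln (real a + 1) \<le> 3 / 4 * M * real (weight a)" by (simp add: mult_ac)
    qed (use \<open>0 \<le> M\<close> in auto)
    also have "\<dots> = (3 * M) * (2 * real k + l) / 4" by simp
    also have "\<dots> \<le> L * (2 * real k + l) / 4"
      using M \<open>0 \<le> l\<close> by (intro divide_right_mono mult_right_mono) auto
    finally have "L * real k \<le> L * ((2 * real k + l) / 4)" by (simp add: mult_ac)
    then have "real k \<le> (2 * real k + l) / 4" using \<open>1 \<le> L\<close> by simp
    then show "2 * real k \<le> log 2 (real b + 1) \<and> 2 * real (sum_list bs) \<le> 3 * log 2 (real b + 1)"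
      using S unfolding l_def[symmetric] by auto
  qed
qed

section \<open>Consequences of the explicit abc conjecture\<close>

lemma rad_int_eq: "x > 0 \<Longrightarrow> rad (int x) = int (\<Prod>(prime_factors x))"
proof -
  assume "x > 0"
  have "{p. prime p \<and> p dvd int x} = int ` prime_factors x"
  proof (intro equalityI subsetI)
    fix p assume p: "p \<in> {p. prime p \<and> p dvd int x}"
    then obtain q where "p = int q" using prime_ge_0_int nonneg_int_cases by blast
    with p show "p \<in> int ` prime_factors x"
      using \<open>x > 0\<close> by (auto simp: prime_factors_dvd)
  qed (use \<open>x > 0\<close> in \<open>auto simp: prime_factors_dvd\<close>)
  then have "rad (int x) = \<Prod>(int ` prime_factors x)" by (simp add: rad_def)
  also have "\<dots> = int (\<Prod>(prime_factors x))"
    by (subst prod.reindex) (auto simp: o_def)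
  finally show ?thesis .
qed

text \<open>The conjecture for the triple \<open>x, 1, x + 1\<close>, with the exponent \<open>7/4\<close> cleared.\<close>
lemma explicit_abc_consecutive:
  fixes x :: nat
  assumes "explicit_abc" and "x > 0"
  shows "(x + 1) ^ 4 < (\<Prod>(prime_factors (x * (x + 1)))) ^ 7"
proof -
  define R where "R = \<Prod>(prime_factors (x * (x + 1)))"
  have "R > 0" unfolding R_def by (intro prod_pos) (auto dest!: in_prime_factors_imp_prime intro: prime_gt_0_nat)
  have "real_of_int (int x + 1) < real_of_int (rad (int x * 1 * (int x + 1))) powr (7 / 4)"
    using assms unfolding explicit_abc_def by (elim allE[of _ "int x"] allE[of _ 1] allE[of _ "int x + 1"]) auto
  moreover have "rad (int x * 1 * (int x + 1)) = int R"
    using rad_int_eq[of "x * (x + 1)"] \<open>x > 0\<close> unfolding R_def by (simp add: algebra_simps)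
  ultimately have "real x + 1 < real R powr (7 / 4)" by simp
  then have "(real x + 1) ^ 4 < (real R powr (7 / 4)) ^ 4"
    by (intro power_strict_mono) auto
  also have "\<dots> = real R powr 7"
    using \<open>R > 0\<close> by (subst powr_power) auto
  also have "\<dots> = real R ^ 7" using \<open>R > 0\<close> powr_realpow[of "real R" 7] by simp
  finally have "real ((x + 1) ^ 4) < real (R ^ 7)"
    by (simp only: of_nat_power of_nat_add of_nat_1)
  then show ?thesis unfolding R_def by (simp only: of_nat_less_iff)
qed

text \<open>
  The \<open>2H\<close> integers involved lie in an interval of length less than \<open>2H\<close>, so a prime above \<open>2H\<close>
  divides at most one of them and is counted once; the primes up to \<open>2H\<close> are counted at most
  \<open>H\<close> times each.
\<close>
lemma prod_prime_factors_pairs_le: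
  fixes b q H :: nat
  assumes q: "\<And>i p. i < H \<Longrightarrow> prime p \<Longrightarrow> p dvd (b + 2 * i + 1) * (b + 2 * i + 2) \<Longrightarrow> p \<le> q"
  shows "(\<Prod>i<H. \<Prod>(prime_factors ((b + 2 * i + 1) * (b + 2 * i + 2)))) \<le> 4 ^ (2 * H * H + q)"
proof -
  define R where "R i = prime_factors ((b + 2 * i + 1) * (b + 2 * i + 2))" for i
  have R: "p \<in> R i \<longleftrightarrow> prime p \<and> (p dvd b + 2 * i + 1 \<or> p dvd b + 2 * i + 2)" for p i
    by (auto simp: R_def prime_factors_dvd prime_dvd_mult_iff simp del: mult_Suc mult_Suc_right)
  have fin: "finite (R i)" for i by (simp add: R_def)
  have le: "\<Prod>P \<le> 4 ^ m" if "P \<subseteq> {p. prime p \<and> p \<le> m}" for P m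
  proof -
    have "\<Prod>P \<le> \<Prod>{p. prime p \<and> p \<le> m}"
      using that by (intro dvd_imp_le prod_dvd_prod_subset) (auto intro!: prod_pos simp: prime_gt_0_nat)
    also have "\<dots> \<le> 4 ^ m" by (rule prod_primes_le_4_power)
    finally show ?thesis .
  qed
  have "(\<Prod>i<H. \<Prod>(R i)) = (\<Prod>i<H. \<Prod>(R i \<inter> {..2 * H}) * \<Prod>(R i - {..2 * H}))"
    by (intro prod.cong refl prod.Int_Diff fin)
  also have "\<dots> = (\<Prod>i<H. \<Prod>(R i \<inter> {..2 * H})) * (\<Prod>i<H. \<Prod>(R i - {..2 * H}))"
    by (rule prod.distrib)
  also have "(\<Prod>i<H. \<Prod>(R i - {..2 * H})) = \<Prod>(\<Union>i<H. R i - {..2 * H})"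
  proof (rule prod.UNION_disjoint[symmetric])
    have disj: "(R i - {..2 * H}) \<inter> (R j - {..2 * H}) = {}" if "i < j" "j < H" for i j
    proof (rule ccontr)
      assume "(R i - {..2 * H}) \<inter> (R j - {..2 * H}) \<noteq> {}"
      then obtain p where "p \<in> R i - {..2 * H}" "p \<in> R j - {..2 * H}" by blast
      then have p: "p \<in> R i" "p \<in> R j" "2 * H < p" by auto
      obtain c where c: "p dvd b + 2 * i + c" "c = 1 \<or> c = 2" using p(1) R by blast
      obtain d where d: "p dvd b + 2 * j + d" "d = 1 \<or> d = 2" using p(2) R by blast
      have "p dvd (b + 2 * j + d) - (b + 2 * i + c)" using c d by (intro dvd_diff_nat)
      moreover have "0 < (b + 2 * j + d) - (b + 2 * i + c)" using that c d by auto
      ultimately have "p \<le> (b + 2 * j + d) - (b + 2 * i + c)" by (rule dvd_imp_le)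
      also have "\<dots> < 2 * H" using that c d by auto
      finally show False using p by simp
    qed
    then show "\<forall>i\<in>{..<H}. \<forall>j\<in>{..<H}. i \<noteq> j \<longrightarrow> (R i - {..2 * H}) \<inter> (R j - {..2 * H}) = {}"
      by (metis Int_commute lessThan_iff linorder_neqE_nat)
  qed (auto simp: fin)
  also have "\<dots> \<le> 4 ^ q"
    using q by (intro le) (auto simp: R_def prime_factors_dvd simp del: mult_Suc mult_Suc_right)
  also have "(\<Prod>i<H. \<Prod>(R i \<inter> {..2 * H})) \<le> (\<Prod>i<H. 4 ^ (2 * H))"
    by (intro prod_mono conjI le) (auto simp: R)
  finally show ?thesis
    by (simp add: R_def power_add power_mult[symmetric] del: mult_Suc mult_Suc_right)
qed

text \<open>
  If \<open>2H\<close> integers just above \<open>b\<close> have only prime factors up to \<open>q\<close>, then, up to a term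
  that depends on \<open>H\<close> only, \<open>q\<close> is at least a multiple of \<open>H ln b\<close>: every pair of
  neighbours has, by the conjecture, a radical of at least \<open>b\<close> to the power \<open>4/7\<close>, while the
  product of these radicals is essentially at most the product of all primes up to \<open>q\<close>.
\<close>
lemma explicit_abc_pairs:
  fixes b q H :: nat
  assumes abc: "explicit_abc"
    and q: "\<And>i p. i < H \<Longrightarrow> prime p \<Longrightarrow> p dvd (b + 2 * i + 1) * (b + 2 * i + 2) \<Longrightarrow> p \<le> q"
  shows "(b + 1) ^ (4 * H) \<le> 4 ^ (7 * (2 * H * H + q))"
proof -
  define R where "R i = \<Prod>(prime_factors ((b + 2 * i + 1) * (b + 2 * i + 2)))" for i
  have "(b + 1) ^ (4 * H) = (\<Prod>i<H. (b + 1) ^ 4)" by (simp add: power_mult)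
  also have "\<dots> \<le> (\<Prod>i<H. R i ^ 7)"
  proof (intro prod_mono conjI)
    fix i
    have "(b + 1) ^ 4 \<le> (b + 2 * i + 1 + 1) ^ 4" by (intro power_mono) auto
    also have "\<dots> \<le> R i ^ 7"
      using explicit_abc_consecutive[OF abc, of "b + 2 * i + 1"] by (simp add: R_def)
    finally show "(b + 1) ^ 4 \<le> R i ^ 7" .
  qed auto
  also have "\<dots> = (\<Prod>i<H. R i) ^ 7" by (simp add: prod_power_distrib)
  also have "\<dots> \<le> (4 ^ (2 * H * H + q)) ^ 7"
    unfolding R_def by (intro power_mono prod_prime_factors_pairs_le q) auto
  finally show ?thesis by (simp add: mult.commute flip: power_mult)
qed

section \<open>Nontrivial reduced solutions are bounded\<close>

lemma prime_dvd_prod_list_two_power_fact: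
  assumes "prime (p::nat)" "p dvd (\<Prod>a\<leftarrow>bs. 2 ^ a * fact a)" "\<forall>a\<in>set bs. 2 \<le> a"
  shows "\<exists>a\<in>set bs. p \<le> a"
  using assms(2,3)
proof (induction bs)
  case (Cons a bs)
  have "p dvd 2 ^ a \<Longrightarrow> p \<le> 2" using assms(1) by (auto dest: prime_dvd_power intro: dvd_imp_le)
  then show ?case using Cons assms(1) by (auto simp: prime_dvd_mult_iff prime_dvd_fact_iff)
qed (use assms(1) in auto)

lemma reduced_solution_prime_le:
  assumes sol: "reduced_solution b k bs" and "1 \<le> j" "j \<le> k" and "prime p" "p dvd b + j"
  shows "\<exists>a\<in>set bs. p \<le> a"
proof -
  have "(b + j) * fact b dvd (b + j) * fact (b + j - 1)"
    using \<open>1 \<le> j\<close> by (intro mult_dvd_mono fact_dvd) auto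
  also have "\<dots> = fact (b + j)" using \<open>1 \<le> j\<close> by (subst fact_reduce[of "b + j"]) auto
  also have "\<dots> dvd (fact (b + k) :: nat)" using \<open>j \<le> k\<close> by (intro fact_dvd) auto
  also have "\<dots> dvd 2 ^ k * fact (b + k)" by simp
  also have "\<dots> = (\<Prod>a\<leftarrow>bs. 2 ^ a * fact a) * fact b" using sol by (simp add: reduced_solution_def)
  finally have "b + j dvd (\<Prod>a\<leftarrow>bs. 2 ^ a * fact a)" by simp
  then show ?thesis
    using assms by (intro prime_dvd_prod_list_two_power_fact) (auto simp: reduced_solution_def)
qed

text \<open>The terms \<open>M ^ n / n!\<close> of the exponential series tend to 0.\<close>
lemma eventually_power_less_fact: "\<exists>N. \<forall>n\<ge>N. M ^ n < (fact n :: nat)"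
proof -
  have "(\<lambda>n. inverse (fact n) * real M ^ n) \<longlonglongrightarrow> 0"
    by (intro summable_LIMSEQ_zero summable_exp)
  then have "eventually (\<lambda>n. inverse (fact n) * real M ^ n < 1) sequentially"
    by (rule order_tendstoD) simp
  then obtain N where N: "\<forall>n\<ge>N. inverse (fact n) * real M ^ n < 1"
    unfolding eventually_sequentially by blast
  have "M ^ n < fact n" if "N \<le> n" for n
  proof -
    have "real M ^ n < fact n" using N that by (simp add: field_simps)
    then have "real (M ^ n) < real (fact n)" by simp
    then show ?thesis by (simp only: of_nat_less_iff)
  qed
  then show ?thesis by blast
qed

lemma reduced_solution_prod_le:
  assumes "reduced_solution b k bs"
  shows "(\<Prod>a\<leftarrow>bs. 2 ^ a * fact a) \<le> (2 * (b + k)) ^ k"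
proof -
  have "(fact (b + i) :: nat) \<le> fact b * (b + k) ^ i" if "i \<le> k" for i
    using that
  proof (induction i)
    case (Suc i)
    have "fact (b + Suc i) = (b + Suc i) * fact (b + i)" by simp
    also have "\<dots> \<le> (b + k) * (fact b * (b + k) ^ i)" using Suc by (intro mult_mono) auto
    finally show ?case by (simp add: mult_ac)
  qed simp
  then have "2 ^ k * fact (b + k) \<le> 2 ^ k * (fact b * (b + k) ^ k)" by (intro mult_left_mono) auto
  moreover have "(2 ^ k * fact (b + k) :: nat) = fact b * (\<Prod>a\<leftarrow>bs. 2 ^ a * fact a)"
    using assms by (simp add: reduced_solution_def)
  moreover have "2 ^ k * (fact b * (b + k) ^ k) = fact b * (2 * (b + k)) ^ k"
    by (simp only: power_mult_distrib mult_ac)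
  ultimately have "fact b * (\<Prod>a\<leftarrow>bs. 2 ^ a * fact a) \<le> fact b * (2 * (b + k)) ^ k"
    by (simp only:)
  then show ?thesis by (simp only: mult_le_cancel1) simp
qed

lemma fact_le_prod_list_two_power_fact:
  assumes "a \<in> set bs" shows "fact a \<le> (\<Prod>a\<leftarrow>bs. 2 ^ a * fact a :: nat)"
proof (rule dvd_imp_le)
  have "fact a dvd (2 ^ a * fact a :: nat)" by simp
  also have "\<dots> dvd (\<Prod>a\<leftarrow>bs. 2 ^ a * fact a)" using assms by (induction bs) auto
  finally show "fact a dvd (\<Prod>a\<leftarrow>bs. 2 ^ a * fact a :: nat)" .
qed (rule prod_list_two_power_fact_pos)

text \<open>
  The conjecture is used twice. With six pairs it forces \<open>k < 12\<close>: six pairs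
  would need the primes up to the sum of \<open>bs\<close> to have a product of order \<open>b ^ (24/7)\<close>, but the
  logarithmic bound allows only \<open>b ^ 3\<close>. With one pair it forces the largest entry \<open>q\<close> of \<open>bs\<close> to be
  at least of order \<open>ln b\<close>; then \<open>q!\<close> grows faster than any power of \<open>b\<close>, whereas for
  \<open>k < 12\<close> it divides a product of size \<open>O(b ^ 11)\<close>.
\<close>
lemma no_large_reduced_solution:
  assumes abc: "explicit_abc"
  shows "\<exists>B. \<forall>b\<ge>B. \<forall>k\<ge>2. \<forall>bs. \<not> reduced_solution b k bs"
proof -
  obtain B1 where B1: "\<And>b k bs. B1 \<le> b \<Longrightarrow> reduced_solution b k bs \<Longrightarrow>
      2 * real k \<le> log 2 (real b + 1) \<and> 2 * real (sum_list bs) \<le> 3 * log 2 (real b + 1)"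
    using reduced_solution_log_bound by blast
  \<comment> \<open>The abc bound \<open>(b + 1) ^ 4 \<le> 4 ^ (14 + 7q)\<close> will give
      \<open>q! \<le> (b + 1) ^ 13 \<le> 4 ^ (13 * (14 + 7q)) \<le> M ^ q\<close>.\<close>
  define M :: nat where "M = 4 ^ 273"
  obtain Q where Q: "\<forall>n\<ge>Q. M ^ n < fact n" using eventually_power_less_fact by blast
  \<comment> \<open>With \<open>H\<close> pairs the abc bound has the exponent \<open>7 * (2 * H * H + q)\<close>: the number 504 comes
      from \<open>H = 6\<close>, and \<open>14 + 7 * Q\<close> from \<open>H = 1\<close>. The term \<open>2 ^ 11\<close> ensures
      \<open>4 ^ 11 \<le> (b + 1) ^ 2\<close>.\<close>
  define B where "B = B1 + 4 ^ 504 + 4 ^ (14 + 7 * Q) + 2 ^ 11"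
  have False if "B \<le> b" "2 \<le> k" and sol: "reduced_solution b k bs" for b k bs
  proof -
    have b: "B1 \<le> b" "4 ^ 504 \<le> b" "4 ^ (14 + 7 * Q) \<le> b" "2 ^ 11 \<le> b"
      using \<open>B \<le> b\<close> unfolding B_def by linarith+
    define S where "S = sum_list bs"
    have S: "a \<le> S" if "a \<in> set bs" for a
      using that member_le_sum_list[of a bs] by (simp add: S_def)
    have "(4::nat) ^ S \<le> (b + 1) ^ 3"
    proof -
      have "2 * real S \<le> log 2 ((real b + 1) ^ 3)"
        using B1[OF b(1) sol] by (simp add: S_def log_nat_power)
      then have "2 powr (2 * real S) \<le> (real b + 1) ^ 3" by (simp add: le_log_iff)
      also have "2 powr (2 * real S) = 4 ^ S"
        using powr_realpow[of 2 "2 * S"] by (simp add: power_mult)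
      finally have "real (4 ^ S) \<le> real ((b + 1) ^ 3)"
        by (simp only: of_nat_power of_nat_add of_nat_1 of_nat_numeral)
      then show ?thesis by (simp only: of_nat_le_iff)
    qed
    have prime_le: "\<exists>a\<in>set bs. p \<le> a"
      if "2 * i + 2 \<le> k" "prime p" "p dvd (b + 2 * i + 1) * (b + 2 * i + 2)" for i p
    proof -
      have "p dvd b + (2 * i + 1) \<or> p dvd b + (2 * i + 2)"
        using that by (simp only: prime_dvd_mult_iff add.assoc)
      then show ?thesis
        using reduced_solution_prime_le[OF sol, of "2 * i + 1" p]
          reduced_solution_prime_le[OF sol, of "2 * i + 2" p] that(1,2) by auto
    qed
    have "k < 12"
    proof (rule ccontr)
      assume "\<not> k < 12"
      have "(b + 1) ^ (4 * 6) \<le> 4 ^ (7 * (2 * 6 * 6 + S))"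
      proof (rule explicit_abc_pairs[OF abc])
        fix i p :: nat
        assume "i < 6" "prime p" "p dvd (b + 2 * i + 1) * (b + 2 * i + 2)"
        with \<open>\<not> k < 12\<close> have "\<exists>a\<in>set bs. p \<le> a" by (intro prime_le[of i]) auto
        then show "p \<le> S" using S order_trans by blast
      qed
      also have "\<dots> = 4 ^ 504 * (4 ^ S) ^ 7" by (simp add: power_add mult.commute flip: power_mult)
      also have "\<dots> \<le> 4 ^ 504 * ((b + 1) ^ 3) ^ 7"
        using \<open>4 ^ S \<le> (b + 1) ^ 3\<close> by (intro mult_left_mono power_mono) auto
      finally have "(b + 1) ^ 21 * (b + 1) ^ 3 \<le> (b + 1) ^ 21 * 4 ^ 504"
        by (simp only: mult.commute flip: power_mult power_add) simp
      then have "(b + 1) ^ 3 \<le> 4 ^ 504" by (simp only: mult_le_cancel1) simp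
      moreover have "b + 1 \<le> (b + 1) ^ 3" by (rule self_le_power) auto
      ultimately show False using b by linarith
    qed
    \<comment> \<open>The element 0 makes the maximum meaningful before \<open>bs\<close> is known to be nonempty.\<close>
    define q where "q = Max (insert 0 (set bs))"
    have q: "a \<le> q" if "a \<in> set bs" for a using that by (simp add: q_def)
    have b4: "(b + 1) ^ (4 * 1) \<le> 4 ^ (7 * (2 * 1 * 1 + q))"
    proof (rule explicit_abc_pairs[OF abc])
      fix i p :: nat
      assume "i < 1" "prime p" "p dvd (b + 2 * i + 1) * (b + 2 * i + 2)"
      with \<open>2 \<le> k\<close> have "\<exists>a\<in>set bs. p \<le> a" by (intro prime_le[of i]) auto
      then show "p \<le> q" using q order_trans by blast
    qed
    have "Q \<le> q"
    proof (rule ccontr)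
      assume "\<not> Q \<le> q"
      have "b + 1 \<le> (b + 1) ^ (4 * 1)" by (rule self_le_power) auto
      also note b4
      also have "4 ^ (7 * (2 * 1 * 1 + q)) \<le> (4 ^ (14 + 7 * Q) :: nat)"
        using \<open>\<not> Q \<le> q\<close> by (intro power_increasing) auto
      finally show False using b by linarith
    qed
    have "q > 0"
    proof (rule ccontr)
      assume "\<not> q > 0"
      have "b + 1 \<le> (b + 1) ^ (4 * 1)" by (rule self_le_power) auto
      also note b4
      also have "4 ^ (7 * (2 * 1 * 1 + q)) \<le> (4 ^ 504 :: nat)"
        using \<open>\<not> q > 0\<close> by (intro power_increasing) auto
      finally show False using b by linarith
    qed
    have "q \<in> insert 0 (set bs)" unfolding q_def by (intro Max_in) auto
    with \<open>q > 0\<close> have "q \<in> set bs" by auto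
    then have "fact q \<le> (\<Prod>a\<leftarrow>bs. 2 ^ a * fact a :: nat)" by (rule fact_le_prod_list_two_power_fact)
    also have "\<dots> \<le> (2 * (b + k)) ^ k" by (rule reduced_solution_prod_le[OF sol])
    also have "\<dots> \<le> (4 * (b + 1)) ^ k" using \<open>k < 12\<close> b(4) by (intro power_mono) auto
    also have "\<dots> \<le> (4 * (b + 1)) ^ 11" using \<open>k < 12\<close> by (intro power_increasing) auto
    also have "\<dots> = (2 ^ 11) ^ 2 * (b + 1) ^ 11" by (simp only: power_mult_distrib) simp
    also have "\<dots> \<le> (b + 1) ^ 2 * (b + 1) ^ 11"
      using b(4) by (intro mult_right_mono power_mono) auto
    also have "\<dots> = (b + 1) ^ 13" by (simp flip: power_add)
    also have "\<dots> \<le> ((b + 1) ^ (4 * 1)) ^ 13" by (simp flip: power_mult add: power_increasing)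
    also have "\<dots> \<le> (4 ^ (7 * (2 * 1 * 1 + q))) ^ 13" by (intro power_mono b4) auto
    also have "\<dots> = 4 ^ (182 + 91 * q)" by (simp flip: power_mult add: algebra_simps)
    also have "\<dots> \<le> 4 ^ (273 * q)" using \<open>q > 0\<close> by (intro power_increasing) auto
    also have "\<dots> = M ^ q" unfolding M_def by (rule power_mult)
    finally have "fact q \<le> M ^ q" .
    then show False using Q \<open>Q \<le> q\<close> leD by blast
  qed
  then show ?thesis by blast
qed

section \<open>Reduction to the reduced equation and finiteness\<close>

lemma last_le_of_sorted_wrt_ge:
  fixes xs :: "nat list"
  assumes "sorted_wrt (\<ge>) xs" "x \<in> set xs"
  shows "last xs \<le> x"
  using assms by (induction xs) (auto split: if_splits)

text \<open>
  The left side of the equation is even, and the double factorial of an odd number is odd, so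
  \<open>n\<close> is even and everything can be halved.
\<close>
lemma solution_imp_reduced_solution:
  assumes sol: "is_solution n as" and even: "\<forall>a\<in>set as. even a"
    and nontrivial: "\<not> trivial_solution n as"
  obtains b k bs where "n = 2 * (b + k)" "2 \<le> k" "as = map ((*) 2) (b # bs)" "reduced_solution b k bs"
proof -
  have eq: "(\<Prod>a\<leftarrow>as. double_fact a) = double_fact n" and len: "length as > 1"
    and n: "n > hd as" and sorted: "sorted_wrt (\<ge>) as" and last: "last as \<ge> 3"
    using sol by (auto simp: is_solution_def)
  define cs where "cs = map (\<lambda>a. a div 2) as"
  have as_cs: "as = map ((*) 2) cs"
    unfolding cs_def map_map by (rule map_idI[symmetric]) (use even in auto)
  obtain b bs where cs: "cs = b # bs" using len as_cs by (cases cs) auto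
  have ge: "2 \<le> a" if "a \<in> set cs" for a
  proof -
    have "2 * a \<in> set as" using that by (simp add: as_cs)
    from last_le_of_sorted_wrt_ge[OF sorted this] last show ?thesis by linarith
  qed
  have le: "a \<le> b" if "a \<in> set bs" for a
    using sorted that by (auto simp: as_cs cs)
  have prod: "(\<Prod>a\<leftarrow>cs. 2 ^ a * fact a) = double_fact n"
    using eq by (simp add: as_cs o_def double_fact_double)
  have "2 \<le> b" using ge cs by simp
  then have "even (2 ^ b * fact b :: nat)" by simp
  then have "even (\<Prod>a\<leftarrow>cs. 2 ^ a * fact a :: nat)" by (simp add: cs)
  then have "even n" using odd_double_fact[of n] prod by auto
  then obtain m where m: "n = 2 * m" by (elim evenE)
  define k where "k = m - b"
  have "b < m" using n by (simp add: as_cs cs m)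
  then have nk: "n = 2 * (b + k)" by (simp add: m k_def)
  have "n - hd as \<noteq> 2" using nontrivial sol by (simp add: trivial_solution_def)
  then have "2 \<le> k" using \<open>b < m\<close> by (simp add: as_cs cs m k_def)
  have "reduced_solution b k bs"
    unfolding reduced_solution_def
  proof (intro conjI ballI)
    have "2 ^ b * (fact b * (\<Prod>a\<leftarrow>bs. 2 ^ a * fact a)) = 2 ^ b * (2 ^ k * fact (b + k) :: nat)"
      using prod unfolding nk double_fact_double by (simp add: cs power_add mult_ac)
    then show "(2 ^ k * fact (b + k) :: nat) = fact b * (\<Prod>a\<leftarrow>bs. 2 ^ a * fact a)" by simp
  qed (use ge le cs in auto)
  with nk \<open>2 \<le> k\<close> as_cs cs show thesis using that by blast
qed

text \<open>
  For the finitely many small \<open>b\<close> the analytic estimates give nothing; but an odd prime in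
  \<open>(b, b + k]\<close> would divide only one side of the reduced equation.
\<close>
lemma reduced_solution_less_prime:
  assumes sol: "reduced_solution b k bs" and "prime p" "b < p" "2 < p"
  shows "b + k < p"
proof (rule ccontr)
  assume "\<not> b + k < p"
  then have "p dvd 2 ^ k * fact (b + k)" using \<open>prime p\<close> by (simp add: prime_dvd_fact_iff)
  then have "p dvd fact b * (\<Prod>a\<leftarrow>bs. 2 ^ a * fact a)" using sol by (simp add: reduced_solution_def)
  then have "p dvd (\<Prod>a\<leftarrow>bs. 2 ^ a * fact a)"
    using \<open>prime p\<close> \<open>b < p\<close> by (simp add: prime_dvd_mult_iff prime_dvd_fact_iff)
  then have "\<exists>a\<in>set bs. p \<le> a"
    using sol \<open>prime p\<close> by (intro prime_dvd_prod_list_two_power_fact) (auto simp: reduced_solution_def)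
  then show False using sol \<open>b < p\<close> by (auto simp: reduced_solution_def)
qed

theorem theorem1p1:
  assumes "explicit_abc"
  shows "finite {(n, as). is_solution n as \<and> (\<forall>a \<in> set as. even a) \<and> \<not> trivial_solution n as}"
proof -
  obtain B where B: "\<forall>b\<ge>B. \<forall>k\<ge>2. \<forall>bs. \<not> reduced_solution b k bs"
    using no_large_reduced_solution[OF assms] by blast
  obtain p :: nat where p: "prime p" "B + 2 < p" using bigger_prime by blast
  have "{(n, as). is_solution n as \<and> (\<forall>a \<in> set as. even a) \<and> \<not> trivial_solution n as} \<subseteq>
      (SIGMA n : {..2 * p}. {as. set as \<subseteq> {..2 * p} \<and> length as \<le> double_fact n})"
  proof (intro subsetI, clarify, intro SigmaI CollectI conjI)
    fix n as
    assume sol: "is_solution n as" and "\<forall>a\<in>set as. even a" "\<not> trivial_solution n as"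
    then obtain b k bs where n: "n = 2 * (b + k)" and "2 \<le> k" and as: "as = map ((*) 2) (b # bs)"
      and red: "reduced_solution b k bs"
      by (rule solution_imp_reduced_solution)
    have "b < B" using B \<open>2 \<le> k\<close> red not_less by blast
    then have "b + k < p" using reduced_solution_less_prime[OF red] p by simp
    then show "n \<in> {..2 * p}" by (simp add: n)
    show "set as \<subseteq> {..2 * p}"
      using \<open>b + k < p\<close> red by (auto simp: as reduced_solution_def)
    \<comment> \<open>Every double factorial in the product is at least 2, which bounds the number of factors.\<close>
    have len: "2 ^ length xs \<le> (\<Prod>a\<leftarrow>xs. double_fact (2 * a))" if "\<forall>a\<in>set xs. 2 \<le> a" for xs
      using that
    proof (induction xs)
      case (Cons a xs)
      have "(2::nat) ^ 1 * 1 \<le> 2 ^ a * fact a"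
        using Cons.prems by (intro mult_mono power_increasing fact_ge_1) auto
      then have "2 \<le> double_fact (2 * a)" by (simp only: double_fact_double) simp
      then have "2 * 2 ^ length xs \<le> double_fact (2 * a) * (\<Prod>a\<leftarrow>xs. double_fact (2 * a))"
        using Cons by (intro mult_mono) auto
      then show ?case by simp
    qed simp
    have "2 \<le> b"
      using sol red by (cases bs) (auto simp: is_solution_def as reduced_solution_def)
    then have "2 ^ length (b # bs) \<le> (\<Prod>a\<leftarrow>b # bs. double_fact (2 * a))"
      using red by (intro len) (auto simp: reduced_solution_def)
    also have "\<dots> = double_fact n" using sol by (simp add: as is_solution_def o_def)
    finally have "2 ^ length as \<le> double_fact n" by (simp add: as)
    then show "length as \<le> double_fact n" using less_exp[of "length as"] by linarith
  qed
  moreover have "finite (SIGMA n : {..2 * p}. {as. set as \<subseteq> {..2 * p} \<and> length as \<le> double_fact n})"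
    by (intro finite_SigmaI finite_lists_length_le) auto
  ultimately show ?thesis by (rule finite_subset)
qed

end
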